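(* Let $(\mathscr{C}, \Sigma, \Delta)$ be a triangulated category with a central ring action from a graded-commutative non-negatively graded ring $H = \bigoplus_{n\ge 0} H^n$, and let $A, B \in \mathscr{C}$ be two objects such that the graded $H$-module $\operatorname{Hom}_{\mathscr{C}}^{\ge n_0}(A,B) = \bigoplus_{n \ge n_0} \operatorname{Hom}_{\mathscr{C}}(A, \Sigma^n B)$ is Noetherian for some $n_0 \in \mathbb{Z}$. Assume that one of the following holds: (1) $\operatorname{Hom}_{\mathscr{C}}(A, \Sigma^n B)$ has finite length over $H^0$ for $n \gg 0$; (2) $H^0$ contains an infinite field, or is local with an infinite residue field. Then either $\operatorname{Hom}_{\mathscr{C}}(A, \Sigma^n B) = 0$ for all $n \gg 0$, or there exist integers $d > 0$ and $m_0$ such that, for at least one integer $j$ with $0 \le j < d$, $\operatorname{Hom}_{\mathscr{C}}(A, \Sigma^n B) \neq 0$ for all $n \ge m_0$ with $n \equiv j \pmod d$.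
   Context: A triangulated category $(\mathscr{C}, \Sigma, \Delta)$ is an additive category $\mathscr{C}$ with an automorphism $\Sigma$ and a collection $\Delta$ of distinguished triangles satisfying Verdier's axioms. For objects $A, B \in \mathscr{C}$ set $\operatorname{Hom}_{\mathscr{C}}^*(A,B) = \bigoplus_{n \in \mathbb{Z}} \operatorname{Hom}_{\mathscr{C}}(A, \Sigma^n B)$. For every object $A$, $\operatorname{Hom}_{\mathscr{C}}^*(A,A)$ is a $\mathbb{Z}$-graded ring under composition products (the product of $g \in \operatorname{Hom}_{\mathscr{C}}(A,\Sigma^m A)$ and $f \in \operatorname{Hom}_{\mathscr{C}}(A,\Sigma^n A)$ is $g \cdot f = \Sigma^n(g) \circ f$); in the same way $\operatorname{Hom}_{\mathscr{C}}^*(A,B)$ is a graded left $\operatorname{Hom}_{\mathscr{C}}^*(B,B)$-module and a graded right $\operatorname{Hom}_{\mathscr{C}}^*(A,A)$-module. A central ring action on $\mathscr{C}$ is a non-negatively graded ring $H = \bigoplus_{n=0}^\infty H^n$ which is graded-commutative (i.e. $xy = (-1)^{mn} yx$ for $x \in H^m$, $y \in H^n$), together with a homomorphism of graded rings $\varphi_A : H \to \operatorname{Hom}_{\mathscr{C}}^*(A,A)$ for every object $A \in \mathscr{C}$, such that for all $A, B \in \mathscr{C}$, $x \in H^m$ and $f \in \operatorname{Hom}_{\mathscr{C}}(A, \Sigma^n B)$ one has $\varphi_B(x) \cdot f = (-1)^{mn} f \cdot \varphi_A(x)$. Thus the left and right actions of $H$ on $\operatorname{Hom}_{\mathscr{C}}^*(A,B)$,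 via $\varphi_B$ and $\varphi_A$ respectively, agree up to sign, and one refers simply to $\operatorname{Hom}_{\mathscr{C}}^*(A,B)$ as a graded $H$-module; $\operatorname{Hom}_{\mathscr{C}}^{\ge n_0}(A,B)$ is a graded submodule of it. *)

theory Defs
  imports "HOL-Algebra.Module" "HOL-Algebra.QuotRing" "HOL-Algebra.Subrings"
    "HOL-Algebra.Product_Groups"
begin

section \<open>Additive categories\<close>

text \<open>Hom-sets of distinct pairs of objects are disjoint, so composition, addition and the
  action of a functor on morphisms need no object indices; a zero morphism does.\<close>

record ('o, 'm) preadd_cat =
  Obj :: "'o set"
  Hom :: "'o \<Rightarrow> 'o \<Rightarrow> 'm set"
  Cmp :: "'m \<Rightarrow> 'm \<Rightarrow> 'm"  (infixl \<open>\<bullet>\<index>\<close> 75)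
  Idt :: "'o \<Rightarrow> 'm"
  Pls :: "'m \<Rightarrow> 'm \<Rightarrow> 'm"  (infixl \<open>\<boxplus>\<index>\<close> 65)
  Zer :: "'o \<Rightarrow> 'o \<Rightarrow> 'm"

text \<open>The group of morphisms, written as a (multiplicative) commutative group.\<close>

definition hom_group :: "('o, 'm, 'z) preadd_cat_scheme \<Rightarrow> 'o \<Rightarrow> 'o \<Rightarrow> 'm monoid" where
  "hom_group C A B = \<lparr>carrier = Hom C A B, monoid.mult = Pls C, one = Zer C A B\<rparr>"

definition arrows :: "('o, 'm, 'z) preadd_cat_scheme \<Rightarrow> 'm set" where
  "arrows C = (\<Union>A\<in>Obj C. \<Union>B\<in>Obj C. Hom C A B)"

definition is_zero_object :: "('o, 'm, 'z) preadd_cat_scheme \<Rightarrow> 'o \<Rightarrow> bool" where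
  "is_zero_object C Z \<longleftrightarrow> Z \<in> Obj C \<and>
     (\<forall>A\<in>Obj C. (\<exists>!f. f \<in> Hom C A Z) \<and> (\<exists>!f. f \<in> Hom C Z A))"

definition is_iso :: "('o, 'm, 'z) preadd_cat_scheme \<Rightarrow> 'o \<Rightarrow> 'o \<Rightarrow> 'm \<Rightarrow> bool" where
  "is_iso C A B f \<longleftrightarrow> f \<in> Hom C A B \<and>
     (\<exists>g\<in>Hom C B A. g \<bullet>\<^bsub>C\<^esub> f = Idt C A \<and> f \<bullet>\<^bsub>C\<^esub> g = Idt C B)"

locale additive_category =
  fixes C :: "('o, 'm, 'z) preadd_cat_scheme" (structure)
  assumes Hom_disjoint:
      "\<lbrakk>A \<in> Obj C; B \<in> Obj C; A' \<in> Obj C; B' \<in> Obj C; f \<in> Hom C A B; f \<in> Hom C A' B'\<rbrakk>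
        \<Longrightarrow> A = A' \<and> B = B'"
    and Idt_closed: "A \<in> Obj C \<Longrightarrow> Idt C A \<in> Hom C A A"
    and Cmp_closed:
      "\<lbrakk>A \<in> Obj C; B \<in> Obj C; D \<in> Obj C; f \<in> Hom C A B; g \<in> Hom C B D\<rbrakk> \<Longrightarrow> g \<bullet> f \<in> Hom C A D"
    and Idt_left: "\<lbrakk>A \<in> Obj C; B \<in> Obj C; f \<in> Hom C A B\<rbrakk> \<Longrightarrow> Idt C B \<bullet> f = f"
    and Idt_right: "\<lbrakk>A \<in> Obj C; B \<in> Obj C; f \<in> Hom C A B\<rbrakk> \<Longrightarrow> f \<bullet> Idt C A = f"
    and Cmp_assoc:
      "\<lbrakk>A \<in> Obj C; B \<in> Obj C; D \<in> Obj C; E \<in> Obj C;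
        f \<in> Hom C A B; g \<in> Hom C B D; h \<in> Hom C D E\<rbrakk> \<Longrightarrow> (h \<bullet> g) \<bullet> f = h \<bullet> (g \<bullet> f)"
    and hom_comm_group: "\<lbrakk>A \<in> Obj C; B \<in> Obj C\<rbrakk> \<Longrightarrow> comm_group (hom_group C A B)"
    and Cmp_distrib_right:
      "\<lbrakk>A \<in> Obj C; B \<in> Obj C; D \<in> Obj C; f \<in> Hom C A B; f' \<in> Hom C A B; g \<in> Hom C B D\<rbrakk>
        \<Longrightarrow> g \<bullet> (f \<boxplus> f') = g \<bullet> f \<boxplus> g \<bullet> f'"
    and Cmp_distrib_left:
      "\<lbrakk>A \<in> Obj C; B \<in> Obj C; D \<in> Obj C; f \<in> Hom C A B; g \<in> Hom C B D; g' \<in> Hom C B D\<rbrakk>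
        \<Longrightarrow> (g \<boxplus> g') \<bullet> f = g \<bullet> f \<boxplus> g' \<bullet> f"
    and zero_object_exists: "\<exists>Z. is_zero_object C Z"
    and biproduct_exists:
      "\<lbrakk>A \<in> Obj C; B \<in> Obj C\<rbrakk> \<Longrightarrow>
        \<exists>P\<in>Obj C. \<exists>i\<in>Hom C A P. \<exists>j\<in>Hom C B P. \<exists>p\<in>Hom C P A. \<exists>q\<in>Hom C P B.
          p \<bullet> i = Idt C A \<and> q \<bullet> j = Idt C B \<and> p \<bullet> j = Zer C B A \<and> q \<bullet> i = Zer C A B \<and>
          i \<bullet> p \<boxplus> j \<bullet> q = Idt C P"


section \<open>Triangulated categories\<close>

text \<open>A triangle \<open>A \<rightarrow> B \<rightarrow> D \<rightarrow> \<Sigma>A\<close> is the triple of its morphisms; the objects are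
  determined by these.\<close>

record ('o, 'm) tri_cat = "('o, 'm) preadd_cat" +
  Shift :: "'o \<Rightarrow> 'o"
  ShiftA :: "'m \<Rightarrow> 'm"
  Dist :: "('m \<times> 'm \<times> 'm) set"

definition is_triangle :: "('o, 'm, 'z) tri_cat_scheme \<Rightarrow> 'o \<Rightarrow> 'o \<Rightarrow> 'o \<Rightarrow> 'm \<Rightarrow> 'm \<Rightarrow> 'm \<Rightarrow> bool" where
  "is_triangle C A B D f g h \<longleftrightarrow> A \<in> Obj C \<and> B \<in> Obj C \<and> D \<in> Obj C \<and>
     f \<in> Hom C A B \<and> g \<in> Hom C B D \<and> h \<in> Hom C D (Shift C A)"

locale triangulated_category = additive_category C
  for C :: "('o, 'm, 'z) tri_cat_scheme" (structure) +
  assumes Shift_bij: "bij_betw (Shift C) (Obj C) (Obj C)"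
    and ShiftA_bij:
      "\<lbrakk>A \<in> Obj C; B \<in> Obj C\<rbrakk>
        \<Longrightarrow> bij_betw (ShiftA C) (Hom C A B) (Hom C (Shift C A) (Shift C B))"
    and ShiftA_Idt: "A \<in> Obj C \<Longrightarrow> ShiftA C (Idt C A) = Idt C (Shift C A)"
    and ShiftA_Cmp:
      "\<lbrakk>A \<in> Obj C; B \<in> Obj C; D \<in> Obj C; f \<in> Hom C A B; g \<in> Hom C B D\<rbrakk>
        \<Longrightarrow> ShiftA C (g \<bullet> f) = ShiftA C g \<bullet> ShiftA C f"
    and ShiftA_Pls:
      "\<lbrakk>A \<in> Obj C; B \<in> Obj C; f \<in> Hom C A B; f' \<in> Hom C A B\<rbrakk>
        \<Longrightarrow> ShiftA C (f \<boxplus> f') = ShiftA C f \<boxplus> ShiftA C f'"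
    and Dist_triangle: "(f, g, h) \<in> Dist C \<Longrightarrow> \<exists>A B D. is_triangle C A B D f g h"
    and TR1_iso:
      "\<lbrakk>(f, g, h) \<in> Dist C; is_triangle C A B D f g h; is_triangle C A' B' D' f' g' h';
        is_iso C A A' a; is_iso C B B' b; is_iso C D D' c;
        b \<bullet> f = f' \<bullet> a; c \<bullet> g = g' \<bullet> b; ShiftA C a \<bullet> h = h' \<bullet> c\<rbrakk>
        \<Longrightarrow> (f', g', h') \<in> Dist C"
    and TR1_Idt:
      "\<lbrakk>A \<in> Obj C; is_zero_object C Z\<rbrakk>
        \<Longrightarrow> (Idt C A, Zer C A Z, Zer C Z (Shift C A)) \<in> Dist C"
    and TR1_cone:
      "\<lbrakk>A \<in> Obj C; B \<in> Obj C; f \<in> Hom C A B\<rbrakk> \<Longrightarrow> \<exists>g h. (f, g, h) \<in> Dist C"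
    and TR2:
      "is_triangle C A B D f g h \<Longrightarrow>
        (f, g, h) \<in> Dist C \<longleftrightarrow>
        (g, h, inv\<^bsub>hom_group C (Shift C A) (Shift C B)\<^esub> (ShiftA C f)) \<in> Dist C"
    and TR3:
      "\<lbrakk>(f, g, h) \<in> Dist C; (f', g', h') \<in> Dist C;
        is_triangle C A B D f g h; is_triangle C A' B' D' f' g' h';
        a \<in> Hom C A A'; b \<in> Hom C B B'; b \<bullet> f = f' \<bullet> a\<rbrakk>
        \<Longrightarrow> \<exists>c\<in>Hom C D D'. c \<bullet> g = g' \<bullet> b \<and> ShiftA C a \<bullet> h = h' \<bullet> c"
    and TR4:
      "\<lbrakk>(f, u, u') \<in> Dist C; (g, v, v') \<in> Dist C; (g \<bullet> f, w, w') \<in> Dist C;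
        is_triangle C A B P f u u'; is_triangle C B D R g v v';
        is_triangle C A D Q (g \<bullet> f) w w'\<rbrakk>
        \<Longrightarrow> \<exists>a\<in>Hom C P Q. \<exists>b\<in>Hom C Q R.
              (a, b, ShiftA C u \<bullet> v') \<in> Dist C \<and>
              a \<bullet> u = w \<bullet> g \<and> w' \<bullet> a = u' \<and> b \<bullet> w = v \<and> v' \<bullet> b = ShiftA C f \<bullet> w'"


section \<open>Graded morphism groups and composition products\<close>

definition int_iterate :: "'a set \<Rightarrow> ('a \<Rightarrow> 'a) \<Rightarrow> int \<Rightarrow> 'a \<Rightarrow> 'a" where
  "int_iterate S f n = (if 0 \<le> n then f ^^ nat n else inv_into S f ^^ nat (- n))"

definition shift_pow :: "('o, 'm, 'z) tri_cat_scheme \<Rightarrow> int \<Rightarrow> 'o \<Rightarrow> 'o" where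
  "shift_pow C = int_iterate (Obj C) (Shift C)"

definition shift_arr_pow :: "('o, 'm, 'z) tri_cat_scheme \<Rightarrow> int \<Rightarrow> 'm \<Rightarrow> 'm" where
  "shift_arr_pow C = int_iterate (arrows C) (ShiftA C)"

text \<open>\<open>Hom\<^sup>n(A, B) = Hom(A, \<Sigma>\<^sup>n B)\<close>, and the graded group \<open>Hom\<^sup>*(A, B)\<close> of finitely supported
  families.\<close>

definition hom_deg :: "('o, 'm, 'z) tri_cat_scheme \<Rightarrow> 'o \<Rightarrow> 'o \<Rightarrow> int \<Rightarrow> 'm monoid" where
  "hom_deg C A B n = hom_group C A (shift_pow C n B)"

definition gr_hom :: "('o, 'm, 'z) tri_cat_scheme \<Rightarrow> 'o \<Rightarrow> 'o \<Rightarrow> (int \<Rightarrow> 'm) monoid" where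
  "gr_hom C A B = sum_group UNIV (hom_deg C A B)"

text \<open>The product of \<open>g\<close> of any degree with \<open>f\<close> of degree \<open>n\<close>.\<close>

definition deg_prod :: "('o, 'm, 'z) tri_cat_scheme \<Rightarrow> int \<Rightarrow> 'm \<Rightarrow> 'm \<Rightarrow> 'm" where
  "deg_prod C n g f = shift_arr_pow C n g \<bullet>\<^bsub>C\<^esub> f"

text \<open>Product of \<open>y \<in> Hom\<^sup>*(B, D)\<close> and \<open>x \<in> Hom\<^sup>*(A, B)\<close>, extended biadditively: the sum in
  degree \<open>k\<close> runs over the finite support of \<open>x\<close>.\<close>

definition gr_prod ::
  "('o, 'm, 'z) tri_cat_scheme \<Rightarrow> 'o \<Rightarrow> 'o \<Rightarrow> 'o \<Rightarrow> (int \<Rightarrow> 'm) \<Rightarrow> (int \<Rightarrow> 'm) \<Rightarrow> int \<Rightarrow> 'm" where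
  "gr_prod C A B D y x = (\<lambda>k. finprod (hom_deg C A D k) (\<lambda>n. deg_prod C n (y (k - n)) (x n))
     {n. x n \<noteq> \<one>\<^bsub>hom_deg C A B n\<^esub>})"

definition gr_end :: "('o, 'm, 'z) tri_cat_scheme \<Rightarrow> 'o \<Rightarrow> (int \<Rightarrow> 'm) ring" where
  "gr_end C A =
     \<lparr>carrier = carrier (gr_hom C A A),
      monoid.mult = gr_prod C A A A,
      one = (\<lambda>n. if n = 0 then Idt C A else \<one>\<^bsub>hom_deg C A A n\<^esub>),
      zero = \<one>\<^bsub>gr_hom C A A\<^esub>,
      add = monoid.mult (gr_hom C A A)\<rparr>"


section \<open>Central ring actions\<close>

locale graded_commutative_ring = ring H
  for H :: "('h, 'y) ring_scheme" (structure) and gr :: "nat \<Rightarrow> 'h set" +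
  assumes gr_subgroup: "subgroup (gr n) (add_monoid H)"
    and gr_direct_sum:
      "x \<in> carrier H \<Longrightarrow>
        \<exists>!c. (\<forall>n. c n \<in> gr n) \<and> finite {n. c n \<noteq> \<zero>} \<and> x = finsum H c {n. c n \<noteq> \<zero>}"
    and gr_mult: "\<lbrakk>x \<in> gr m; y \<in> gr n\<rbrakk> \<Longrightarrow> x \<otimes> y \<in> gr (m + n)"
    and gr_one: "\<one> \<in> gr 0"
    and gr_commute:
      "\<lbrakk>x \<in> gr m; y \<in> gr n\<rbrakk> \<Longrightarrow> x \<otimes> y = (if even (m * n) then y \<otimes> x else \<ominus> (y \<otimes> x))"

definition degree_zero_ring :: "('h, 'y) ring_scheme \<Rightarrow> (nat \<Rightarrow> 'h set) \<Rightarrow> ('h, 'y) ring_scheme" where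
  "degree_zero_ring H gr = H\<lparr>carrier := gr 0\<rparr>"

locale central_ring_action =
  triangulated_category C + graded_commutative_ring H gr
  for C :: "('o, 'm, 'z) tri_cat_scheme" and H :: "('h, 'y) ring_scheme" and gr :: "nat \<Rightarrow> 'h set" +
  fixes \<phi> :: "'o \<Rightarrow> 'h \<Rightarrow> int \<Rightarrow> 'm"
  assumes \<phi>_hom: "A \<in> Obj C \<Longrightarrow> \<phi> A \<in> ring_hom H (gr_end C A)"
    and \<phi>_graded:
      "\<lbrakk>A \<in> Obj C; x \<in> gr m; k \<noteq> int m\<rbrakk> \<Longrightarrow> \<phi> A x k = \<one>\<^bsub>hom_deg C A A k\<^esub>"
    and \<phi>_central:
      "\<lbrakk>A \<in> Obj C; B \<in> Obj C; x \<in> gr m; f \<in> Hom C A (shift_pow C n B)\<rbrakk> \<Longrightarrow>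
        deg_prod C n (\<phi> B x (int m)) f =
          (if even (int m * n) then deg_prod C (int m) f (\<phi> A x (int m))
           else inv\<^bsub>hom_deg C A B (int m + n)\<^esub> (deg_prod C (int m) f (\<phi> A x (int m))))"

text \<open>Left modules over a ring that need not be commutative, as records for the library's
  notion of submodule; the ring multiplication and unit of the record are irrelevant.
  \<open>hom_module\<close> is meant over \<open>H\<^sup>0\<close>: for such \<open>h\<close> only the degree 0 component of \<open>\<phi> B h\<close> is
  nonzero.\<close>

definition hom_module ::
  "('o, 'm, 'z) tri_cat_scheme \<Rightarrow> ('o \<Rightarrow> 'h \<Rightarrow> int \<Rightarrow> 'm) \<Rightarrow> 'o \<Rightarrow> 'o \<Rightarrow> int \<Rightarrow> ('h, 'm) module" where
  "hom_module C \<phi> A B n =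
     \<lparr>carrier = carrier (hom_deg C A B n), monoid.mult = undefined, one = undefined,
      zero = \<one>\<^bsub>hom_deg C A B n\<^esub>, add = monoid.mult (hom_deg C A B n),
      smult = (\<lambda>h f. deg_prod C n (\<phi> B h 0) f)\<rparr>"

definition gr_hom_ge_module ::
  "('o, 'm, 'z) tri_cat_scheme \<Rightarrow> ('o \<Rightarrow> 'h \<Rightarrow> int \<Rightarrow> 'm) \<Rightarrow> 'o \<Rightarrow> 'o \<Rightarrow> int
    \<Rightarrow> ('h, int \<Rightarrow> 'm) module" where
  "gr_hom_ge_module C \<phi> A B n\<^sub>0 =
     \<lparr>carrier = {x \<in> carrier (gr_hom C A B). \<forall>n<n\<^sub>0. x n = \<one>\<^bsub>hom_deg C A B n\<^esub>},
      monoid.mult = undefined, one = undefined,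
      zero = \<one>\<^bsub>gr_hom C A B\<^esub>, add = monoid.mult (gr_hom C A B),
      smult = (\<lambda>h x. gr_prod C A B B (\<phi> B h) x)\<rparr>"

definition noetherian_module :: "('r, 'y) ring_scheme \<Rightarrow> ('r, 'b, 'w) module_scheme \<Rightarrow> bool" where
  "noetherian_module R M \<longleftrightarrow>
     (\<forall>N. submodule N R M \<longrightarrow>
        (\<exists>S\<subseteq>carrier M. finite S \<and> N = \<Inter>{K. submodule K R M \<and> S \<subseteq> K}))"

text \<open>Existence of a composition series.\<close>

definition finite_length :: "('r, 'y) ring_scheme \<Rightarrow> ('r, 'b, 'w) module_scheme \<Rightarrow> bool" where
  "finite_length R M \<longleftrightarrow>
     (\<exists>l::nat. \<exists>N. N 0 = {\<zero>\<^bsub>M\<^esub>} \<and> N l = carrier M \<and> (\<forall>i\<le>l. submodule (N i) R M) \<and>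
        (\<forall>i<l. N i \<subset> N (Suc i) \<and> \<not> (\<exists>K. submodule K R M \<and> N i \<subset> K \<and> K \<subset> N (Suc i))))"

definition contains_infinite_field :: "('r, 'y) ring_scheme \<Rightarrow> bool" where
  "contains_infinite_field R \<longleftrightarrow> (\<exists>K. subfield K R \<and> infinite K)"

definition local_with_infinite_residue_field :: "('r, 'y) ring_scheme \<Rightarrow> bool" where
  "local_with_infinite_residue_field R \<longleftrightarrow>
     (\<exists>I. maximalideal I R \<and> (\<forall>J. maximalideal J R \<longrightarrow> J = I) \<and> infinite (carrier (R Quot I)))"

end

theory Submission
  imports Defs
begin

text \<open>Write \<open>T\<^sub>n = Hom(A, \<Sigma>\<^sup>n B)\<close> for all \<open>n\<close> that are at least \<open>0\<close> and the given bound, and suppose that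
  \<open>T\<^sub>n\<close> is nonzero for infinitely many \<open>n\<close>. Call a family of subgroups \<open>N\<^sub>n \<subseteq> T\<^sub>n\<close> that is stable
  under the homogeneous elements of \<open>H\<close> a graded submodule. Graded submodules correspond to
  certain submodules of the Noetherian module \<open>Hom\<^sup>\<ge>(A, B)\<close>, so every nonempty set of them has a
  maximal element. In particular there is a graded submodule \<open>N\<close> that is maximal among those with
  \<open>T\<^sub>n \<noteq> N\<^sub>n\<close> for infinitely many \<open>n\<close>; the zero family is one such.

  Some homogeneous \<open>u \<in> H\<close> of positive degree \<open>m\<close> does not map \<open>T\<close> into \<open>N\<close>. Otherwise replacing
  \<open>N\<^sub>n\<close> by \<open>T\<^sub>n\<close> in all degrees \<open>n \<le> D\<close> gives a graded submodule for every \<open>D\<close>. These families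
  increase with \<open>D\<close>, so they become stationary, which forces \<open>N\<^sub>n = T\<^sub>n\<close> in all large degrees.

  By graded commutativity \<open>N + uT\<close> is again a graded submodule, and it is strictly larger than
  \<open>N\<close>. Maximality yields \<open>T\<^sub>n = N\<^sub>n + u T\<^sub>n\<^sub>-\<^sub>m\<close> for all large \<open>n\<close>. Hence \<open>T\<^sub>n \<noteq> N\<^sub>n\<close> implies
  \<open>T\<^sub>n\<^sub>-\<^sub>m \<noteq> N\<^sub>n\<^sub>-\<^sub>m\<close> for these \<open>n\<close>. As infinitely many \<open>n\<close> with \<open>T\<^sub>n \<noteq> N\<^sub>n\<close> lie in one residue class
  modulo \<open>m\<close>, descending in steps of \<open>m\<close> shows that \<open>T\<^sub>n \<noteq> N\<^sub>n\<close>, and so \<open>T\<^sub>n \<noteq> 0\<close>, for every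
  large \<open>n\<close> in that class.

  This argument is \<open>nonzero_residue_class\<close>, stated for a sequence of abelian groups with
  operators that commute up to sign. The lemmas \<open>noetherian_module_maximal\<close>,
  \<open>submodule_direct_sum\<close> and \<open>direct_sum_le_cancel\<close> transfer the Noetherian hypothesis to graded
  submodules, and \<open>scalars_commute\<close> derives the sign rule from centrality of the action.\<close>

section \<open>Graded groups with operators\<close>

text \<open>The part of a graded module over a graded-commutative ring that the argument sees: the set
  \<open>ops m\<close> of homogeneous operators of degree \<open>m\<close>, which commute up to sign. The groups are
  written multiplicatively, so the zero module is the family of \<open>\<one>\<close> and a sign is an inverse.\<close>

locale graded_operators =
  fixes G :: "nat \<Rightarrow> 'a monoid" and ops :: "nat \<Rightarrow> 'u set" and act :: "nat \<Rightarrow> 'u \<Rightarrow> 'a \<Rightarrow> 'a"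
  assumes comm_group_G: "comm_group (G i)"
    and act_hom: "u \<in> ops m \<Longrightarrow> act i u \<in> hom (G i) (G (i + m))"
    and act_commute: "\<lbrakk>u \<in> ops m; v \<in> ops l; f \<in> carrier (G i)\<rbrakk> \<Longrightarrow>
      act (i + l) u (act i v f) = act (i + m) v (act i u f) \<or>
      act (i + l) u (act i v f) = inv\<^bsub>G (i + m + l)\<^esub> (act (i + m) v (act i u f))"
begin

lemma group_G: "group (G i)"
  using comm_group_G comm_group.axioms(2) by blast

lemma group_hom_act:
  assumes "u \<in> ops m"
  shows "group_hom (G i) (G (i + m)) (act i u)"
  using group_G act_hom[OF assms] by (simp add: group_hom_def group_hom_axioms_def)

definition graded_submodule :: "(nat \<Rightarrow> 'a set) \<Rightarrow> bool" where
  "graded_submodule N \<longleftrightarrow> (\<forall>i. subgroup (N i) (G i)) \<and>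
     (\<forall>m. \<forall>u\<in>ops m. \<forall>i. \<forall>f\<in>N i. act i u f \<in> N (i + m))"

lemma graded_submoduleD:
  assumes "graded_submodule N"
  shows "subgroup (N i) (G i)"
    and "\<lbrakk>u \<in> ops m; f \<in> N i\<rbrakk> \<Longrightarrow> act i u f \<in> N (i + m)"
  using assms unfolding graded_submodule_def by blast+

lemma graded_submodule_zero: "graded_submodule (\<lambda>i. {\<one>\<^bsub>G i\<^esub>})"
  unfolding graded_submodule_def
  using group.triv_subgroup[OF group_G] group_hom.hom_one[OF group_hom_act] by auto

lemma graded_submodule_sum:
  assumes N: "graded_submodule N" and K: "graded_submodule K"
  shows "graded_submodule (\<lambda>i. N i <#>\<^bsub>G i\<^esub> K i)"
  unfolding graded_submodule_def
proof (intro conjI allI ballI)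
  fix i show "subgroup (N i <#>\<^bsub>G i\<^esub> K i) (G i)"
    using comm_group.mult_subgroups[OF comm_group_G] N K graded_submoduleD(1) by blast
next
  fix m u i f assume u: "u \<in> ops m" and "f \<in> N i <#>\<^bsub>G i\<^esub> K i"
  then obtain a b where ab: "a \<in> N i" "b \<in> K i" "f = a \<otimes>\<^bsub>G i\<^esub> b"
    unfolding set_mult_def by blast
  have "act i u f = act i u a \<otimes>\<^bsub>G (i + m)\<^esub> act i u b"
    unfolding ab(3)
    using ab subgroup.mem_carrier[OF graded_submoduleD(1)] N K
    by (intro group_hom.hom_mult[OF group_hom_act[OF u]]) blast+
  then show "act i u f \<in> N (i + m) <#>\<^bsub>G (i + m)\<^esub> K (i + m)"
    using graded_submoduleD(2)[OF N u ab(1)] graded_submoduleD(2)[OF K u ab(2)]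
    unfolding set_mult_def by blast
qed

text \<open>The family \<open>u T\<close> for an operator \<open>u\<close> of degree \<open>m\<close>. Nothing is hit in degrees below \<open>m\<close>,
  where \<open>n - m\<close> would be truncated to \<open>0\<close>.\<close>

definition image_family :: "nat \<Rightarrow> 'u \<Rightarrow> (nat \<Rightarrow> 'a set) \<Rightarrow> nat \<Rightarrow> 'a set" where
  "image_family m u T n = (if m \<le> n then act (n - m) u ` T (n - m) else {\<one>\<^bsub>G n\<^esub>})"

text \<open>For \<open>f = u g\<close> and another operator \<open>v\<close> the sign rule gives \<open>v (u g) = \<plusminus> u (v g)\<close>, and the
  sign is harmless because the image of a subgroup is closed under inverses.\<close>

lemma graded_submodule_image:
  assumes T: "graded_submodule T" and u: "u \<in> ops m"
  shows "graded_submodule (image_family m u T)"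
  unfolding graded_submodule_def
proof (intro conjI allI ballI)
  fix n show "subgroup (image_family m u T n) (G n)"
  proof (cases "m \<le> n")
    case True
    then show ?thesis
      using group_hom.subgroup_img_is_subgroup[OF group_hom_act[OF u, of "n - m"]
          graded_submoduleD(1)[OF T]]
      by (simp add: image_family_def)
  next
    case False
    then show ?thesis by (simp add: image_family_def group.triv_subgroup[OF group_G])
  qed
next
  fix l v n f assume v: "v \<in> ops l" and f: "f \<in> image_family m u T n"
  show "act n v f \<in> image_family m u T (n + l)"
  proof (cases "m \<le> n")
    case True
    define i where "i = n - m"
    have n: "n = i + m" using True by (simp add: i_def)
    obtain g where g: "g \<in> T i" "f = act i u g"
      using f True by (auto simp: image_family_def i_def)
    have gT: "g \<in> carrier (G i)"
      using g(1) subgroup.mem_carrier[OF graded_submoduleD(1)[OF T]] by blast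
    have vg: "act i v g \<in> T (i + l)" using graded_submoduleD(2)[OF T v g(1)] .
    have sub: "subgroup (act (i + l) u ` T (i + l)) (G (i + l + m))"
      by (rule group_hom.subgroup_img_is_subgroup[OF group_hom_act[OF u]
          graded_submoduleD(1)[OF T]])
    have "act n v f \<in> act (i + l) u ` T (i + l)"
      using act_commute[OF v u gT] subgroup.m_inv_closed[OF sub] vg
      unfolding n g(2) by (metis image_eqI)
    moreover have "image_family m u T (n + l) = act (i + l) u ` T (i + l)"
      by (simp add: image_family_def n add.commute)
    ultimately show ?thesis by simp
  next
    case False
    then have "act n v f = \<one>\<^bsub>G (n + l)\<^esub>"
      using f group_hom.hom_one[OF group_hom_act[OF v]] by (simp add: image_family_def)
    moreover have "\<one>\<^bsub>G (n + l)\<^esub> \<in> image_family m u T (n + l)"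
    proof (cases "m \<le> n + l")
      case True
      then show ?thesis
        using group_hom.hom_one[OF group_hom_act[OF u, of "n + l - m"]]
          subgroup.one_closed[OF graded_submoduleD(1)[OF T, of "n + l - m"]]
        by (force simp: image_family_def)
    qed (simp add: image_family_def)
    ultimately show ?thesis by simp
  qed
qed

text \<open>An operator of positive degree sends everything into \<open>N\<close>, and one of degree \<open>0\<close> cannot cross
  the cut at \<open>D\<close>.\<close>

lemma graded_submodule_truncate:
  assumes T: "graded_submodule T" and N: "graded_submodule N" and NT: "\<And>i. N i \<subseteq> T i"
    and shift: "\<And>m u i f. \<lbrakk>0 < m; u \<in> ops m; f \<in> T i\<rbrakk> \<Longrightarrow> act i u f \<in> N (i + m)"
  shows "graded_submodule (\<lambda>i. if i \<le> D then T i else N i)"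
  unfolding graded_submodule_def
proof (intro conjI allI ballI)
  fix i show "subgroup (if i \<le> D then T i else N i) (G i)"
    using graded_submoduleD(1) T N by simp
next
  fix m u i f assume u: "u \<in> ops m" and f: "f \<in> (if i \<le> D then T i else N i)"
  then have fT: "f \<in> T i" using NT by (auto split: if_splits)
  show "act i u f \<in> (if i + m \<le> D then T (i + m) else N (i + m))"
  proof (cases "m = 0")
    case True
    then show ?thesis
      using f graded_submoduleD(2)[OF T u] graded_submoduleD(2)[OF N u] by (auto split: if_splits)
  next
    case False
    then have "act i u f \<in> N (i + m)" using shift u fT by blast
    then show ?thesis using NT by auto
  qed
qed

text \<open>The maximal condition on graded submodules replaces finite generation. It is used twice: to
  choose a maximal \<open>N\<close> with \<open>T/N\<close> nonzero in arbitrarily large degrees, and to make the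
  truncations of \<open>T\<close> over \<open>N\<close> stationary.\<close>

theorem nonzero_residue_class:
  assumes T: "graded_submodule T"
    and maximal: "\<And>F. \<lbrakk>F \<noteq> {}; \<And>N. N \<in> F \<Longrightarrow> graded_submodule N \<and> (\<forall>i. N i \<subseteq> T i)\<rbrakk> \<Longrightarrow>
      \<exists>N\<in>F. \<forall>N'\<in>F. (\<forall>i. N i \<subseteq> N' i) \<longrightarrow> N' = N"
    and unbounded: "\<And>b. \<exists>n\<ge>b. T n \<noteq> {\<one>\<^bsub>G n\<^esub>}"
  shows "\<exists>d>0. \<exists>b r. \<forall>n\<ge>b. n mod d = r mod d \<longrightarrow> T n \<noteq> {\<one>\<^bsub>G n\<^esub>}"
proof -
  define F where "F = {N. graded_submodule N \<and> (\<forall>i. N i \<subseteq> T i) \<and> (\<forall>b. \<exists>n\<ge>b. T n \<noteq> N n)}"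
  have T_sub: "subgroup (T i) (G i)" for i using graded_submoduleD(1)[OF T] .
  have "(\<lambda>i. {\<one>\<^bsub>G i\<^esub>}) \<in> F"
    using unbounded graded_submodule_zero subgroup.one_closed[OF T_sub] by (simp add: F_def)
  then have "F \<noteq> {}" by blast
  then have "\<exists>N\<in>F. \<forall>N'\<in>F. (\<forall>i. N i \<subseteq> N' i) \<longrightarrow> N' = N"
    by (rule maximal) (simp add: F_def)
  then obtain N where "N \<in> F"
    and N_max: "\<And>N'. \<lbrakk>N' \<in> F; \<And>i. N i \<subseteq> N' i\<rbrakk> \<Longrightarrow> N' = N"
    by auto
  then have N: "graded_submodule N" and NT: "\<And>i. N i \<subseteq> T i"
    and N_unb: "\<And>b. \<exists>n\<ge>b. T n \<noteq> N n"
    by (auto simp: F_def)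
  have N_sub: "subgroup (N i) (G i)" for i using graded_submoduleD(1)[OF N] .
  \<comment> \<open>If all operators of positive degree killed \<open>T/N\<close>, then \<open>T/N\<close> would be bounded.\<close>
  have "\<exists>m u i. 0 < m \<and> u \<in> ops m \<and> (\<exists>f\<in>T i. act i u f \<notin> N (i + m))"
  proof (rule ccontr)
    assume "\<not> ?thesis"
    then have shift: "\<And>m u i f. \<lbrakk>0 < m; u \<in> ops m; f \<in> T i\<rbrakk> \<Longrightarrow> act i u f \<in> N (i + m)"
      by blast
    define tr where "tr = (\<lambda>D i. if i \<le> D then T i else N i)"
    have "\<exists>K\<in>range tr. \<forall>K'\<in>range tr. (\<forall>i. K i \<subseteq> K' i) \<longrightarrow> K' = K"
      using graded_submodule_truncate[OF T N NT shift]
      by (intro maximal) (auto simp: tr_def split: if_splits intro: subsetD[OF NT])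
    then obtain D where D: "\<And>E. (\<forall>i. tr D i \<subseteq> tr E i) \<longrightarrow> tr E = tr D" by blast
    have "T n = N n" if "n > D" for n
    proof -
      have "tr n = tr D" using D[of n] NT that by (auto simp: tr_def)
      then have "tr n n = tr D n" by simp
      then show ?thesis using that by (simp add: tr_def)
    qed
    then show False using N_unb[of "Suc D"] by auto
  qed
  then obtain m u i f where m: "0 < m" and u: "u \<in> ops m" and f: "f \<in> T i" "act i u f \<notin> N (i + m)"
    by blast
  \<comment> \<open>\<open>N + u T\<close> is too large for \<open>F\<close>, so it agrees with \<open>T\<close> in large degrees.\<close>
  define N' where "N' = (\<lambda>n. N n <#>\<^bsub>G n\<^esub> image_family m u T n)"
  have I: "graded_submodule (image_family m u T)" by (rule graded_submodule_image[OF T u])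
  have I_sub: "subgroup (image_family m u T n) (G n)" for n using graded_submoduleD(1)[OF I] .
  have IT: "image_family m u T n \<subseteq> T n" for n
  proof (cases "m \<le> n")
    case True
    then show ?thesis
      using graded_submoduleD(2)[OF T u, of _ "n - m"] by (auto simp: image_family_def)
  qed (simp add: image_family_def subgroup.one_closed[OF T_sub])
  have N': "graded_submodule N'"
    unfolding N'_def by (rule graded_submodule_sum[OF N I])
  have N'T: "N' n \<subseteq> T n" for n
    using NT IT subgroup.m_closed[OF T_sub] unfolding N'_def set_mult_def by blast
  have NN': "N n \<subseteq> N' n" for n
  proof
    fix x assume x: "x \<in> N n"
    then have "x = x \<otimes>\<^bsub>G n\<^esub> \<one>\<^bsub>G n\<^esub>"
      using subgroup.mem_carrier[OF N_sub] monoid.r_one[OF group.is_monoid[OF group_G]] by metis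
    then show "x \<in> N' n"
      using x subgroup.one_closed[OF I_sub] unfolding N'_def set_mult_def by blast
  qed
  have "act i u f \<in> N' (i + m)"
  proof -
    have y: "act i u f \<in> image_family m u T (i + m)" using f(1) by (simp add: image_family_def)
    then have "act i u f = \<one>\<^bsub>G (i + m)\<^esub> \<otimes>\<^bsub>G (i + m)\<^esub> act i u f"
      using subgroup.mem_carrier[OF I_sub] monoid.l_one[OF group.is_monoid[OF group_G]] by metis
    then show ?thesis
      using y subgroup.one_closed[OF N_sub] unfolding N'_def set_mult_def by blast
  qed
  then have "N' \<noteq> N" using f(2) by auto
  then have "N' \<notin> F" using N_max NN' by blast
  then obtain b where b: "\<forall>n\<ge>b. T n = N' n"
    using N' N'T by (auto simp: F_def)
  define E where "E = {n. T n \<noteq> N n}"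
  \<comment> \<open>In degree \<open>n + m\<close> the group \<open>T\<close> is generated by \<open>N\<close> and \<open>u T\<^sub>n\<close>; if \<open>T\<^sub>n = N\<^sub>n\<close>, both lie in \<open>N\<close>.\<close>
  have step: "n \<in> E" if "n + m \<in> E" "n + m \<ge> b" for n
  proof (rule ccontr)
    assume "n \<notin> E"
    then have eq: "T n = N n" by (simp add: E_def)
    have "T (n + m) \<subseteq> N (n + m)"
    proof
      fix x assume "x \<in> T (n + m)"
      then have "x \<in> N' (n + m)" using b that(2) by simp
      then obtain a g where ag: "a \<in> N (n + m)" "g \<in> T n" "x = a \<otimes>\<^bsub>G (n + m)\<^esub> act n u g"
        unfolding N'_def set_mult_def image_family_def by auto
      then have "act n u g \<in> N (n + m)" using graded_submoduleD(2)[OF N u] eq by simp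
      then show "x \<in> N (n + m)" using ag subgroup.m_closed[OF N_sub] by simp
    qed
    then show False using that(1) NT[of "n + m"] by (auto simp: E_def)
  qed
  have descend: "n \<in> E" if "n + k * m \<in> E" "n \<ge> b" for n k
    using that
  proof (induction k)
    case (Suc k)
    have "n + Suc k * m = n + k * m + m" by simp
    then have "n + k * m + m \<in> E" using Suc.prems(1) by (simp only:)
    then have "n + k * m \<in> E" using step Suc.prems(2) by simp
    then show ?case using Suc.IH Suc.prems(2) by blast
  qed simp
  have "infinite E"
    unfolding infinite_nat_iff_unbounded_le E_def using N_unb by auto
  moreover have "finite ((\<lambda>n. n mod m) ` E)"
    by (rule finite_subset[of _ "{..<m}"]) (use m in auto)
  ultimately obtain r where r: "infinite {n\<in>E. n mod m = r mod m}"
    using pigeonhole_infinite[of E "\<lambda>n. n mod m"] by blast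
  have "T n \<noteq> {\<one>\<^bsub>G n\<^esub>}" if n: "n \<ge> b" "n mod m = r mod m" for n
  proof -
    obtain e where e: "e \<in> E" "e mod m = r mod m" "e \<ge> n"
      using r unfolding infinite_nat_iff_unbounded_le by blast
    then have "m dvd e - n" using n(2) by (metis mod_eq_dvd_iff_nat)
    then obtain k where "e - n = m * k" by blast
    then have "e = n + k * m" using e(3) by (simp add: mult.commute)
    then have "T n \<noteq> N n" using descend[of n k] e(1) n(1) by (simp add: E_def)
    then show ?thesis using NT[of n] subgroup.one_closed[OF N_sub[of n]] by auto
  qed
  then show ?thesis using m by blast
qed

end

section \<open>Noetherian modules\<close>

text \<open>The union of a chain of submodules is a submodule. Its finitely many generators already lie in
  one member of the chain, which is therefore the whole union, and Zorn's lemma applies.\<close>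

lemma noetherian_module_maximal:
  assumes noeth: "noetherian_module R M" and ne: "\<A> \<noteq> {}"
    and sub: "\<And>N. N \<in> \<A> \<Longrightarrow> submodule N R M"
  shows "\<exists>N\<in>\<A>. \<forall>K\<in>\<A>. N \<subseteq> K \<longrightarrow> K = N"
proof (rule subset_Zorn_nonempty[OF ne])
  fix \<C> assume C_ne: "\<C> \<noteq> {}" and "subset.chain \<A> \<C>"
  then have C_sub: "\<C> \<subseteq> \<A>" and total: "\<And>X Y. \<lbrakk>X \<in> \<C>; Y \<in> \<C>\<rbrakk> \<Longrightarrow> X \<subseteq> Y \<or> Y \<subseteq> X"
    unfolding subset_chain_def by auto
  have S: "submodule X R M" if "X \<in> \<C>" for X using sub C_sub that by blast
  have S': "subgroup X (add_monoid M)" if "X \<in> \<C>" for X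
    using S[OF that] unfolding submodule_def by blast
  have "submodule (\<Union>\<C>) R M"
  proof (unfold submodule_def submodule_axioms_def, intro conjI allI impI subgroup.intro)
    show "\<Union>\<C> \<subseteq> carrier (add_monoid M)" using subgroup.subset[OF S'] by blast
    show "x \<otimes>\<^bsub>add_monoid M\<^esub> y \<in> \<Union>\<C>" if xy: "x \<in> \<Union>\<C>" "y \<in> \<Union>\<C>" for x y
    proof -
      obtain X Y where "X \<in> \<C>" "Y \<in> \<C>" "x \<in> X" "y \<in> Y" using xy by blast
      then obtain Z where "Z \<in> \<C>" "x \<in> Z" "y \<in> Z" using total[of X Y] by blast
      then show ?thesis using subgroup.m_closed[OF S'] by blast
    qed
    show "\<one>\<^bsub>add_monoid M\<^esub> \<in> \<Union>\<C>" using C_ne subgroup.one_closed[OF S'] by blast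
    show "inv\<^bsub>add_monoid M\<^esub> x \<in> \<Union>\<C>" if "x \<in> \<Union>\<C>" for x
      using that subgroup.m_inv_closed[OF S'] by blast
    show "a \<odot>\<^bsub>M\<^esub> x \<in> \<Union>\<C>" if "a \<in> carrier R" "x \<in> \<Union>\<C>" for a x
      using that submodule.smult_closed[OF S] by blast
  qed
  from noeth[unfolded noetherian_module_def, rule_format, OF this]
  obtain Q where Q: "finite Q" "\<Union>\<C> = \<Inter>{K. submodule K R M \<and> Q \<subseteq> K}"
    by auto
  have "Q \<subseteq> \<Union>\<C>" unfolding Q(2) by blast
  with Q(1) have "\<exists>X\<in>\<C>. Q \<subseteq> X"
  proof (induction Q rule: finite_induct)
    case empty
    then show ?case using C_ne by blast
  next
    case (insert q Q)
    then obtain X Y where "X \<in> \<C>" "Q \<subseteq> X" "Y \<in> \<C>" "q \<in> Y" by blast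
    then show ?case using total[of X Y] by blast
  qed
  then obtain X where X: "X \<in> \<C>" "Q \<subseteq> X" by blast
  then have "\<Union>\<C> \<subseteq> X" using S[of X] unfolding Q(2) by blast
  then have "\<Union>\<C> = X" using X(1) by blast
  then show "\<Union>\<C> \<in> \<A>" using X(1) C_sub by auto
qed


section \<open>Shifts and composition\<close>

lemma int_iterate_int [simp]: "int_iterate S f (int n) = f ^^ n"
  by (simp add: int_iterate_def)

lemma int_iterate_closed:
  assumes f: "bij_betw f S S" and x: "x \<in> S"
  shows "int_iterate S f k x \<in> S"
proof -
  have "f y \<in> S" "inv_into S f y \<in> S" if "y \<in> S" for y
    using that f bij_betw_apply[OF f] bij_betw_apply[OF bij_betw_inv_into[OF f]] by blast+
  then have "(f ^^ n) x \<in> S" "(inv_into S f ^^ n) x \<in> S" for n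
    by (induction n) (simp_all add: x)
  then show ?thesis by (simp add: int_iterate_def)
qed

text \<open>The exponent \<open>k\<close> may be negative: a component of \<open>\<phi> B h\<close> in a negative degree is zero, but it
  still is a morphism into a negative shift of \<open>B\<close>, and the degrees must add up.\<close>

lemma int_iterate_add:
  assumes f: "bij_betw f S S" and x: "x \<in> S"
  shows "(f ^^ n) (int_iterate S f k x) = int_iterate S f (int n + k) x"
proof (induction n)
  case (Suc n)
  have step: "f (int_iterate S f k x) = int_iterate S f (k + 1) x" for k
  proof (cases "0 \<le> k")
    case True
    then show ?thesis by (simp add: int_iterate_def nat_add_distrib)
  next
    case False
    define j where "j = nat (- (k + 1))"
    have k: "nat (- k) = Suc j" using False by (simp add: j_def)
    have "int_iterate S f (k + 1) x = (inv_into S f ^^ j) x"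
    proof (cases "k = - 1")
      case True
      then show ?thesis by (simp add: int_iterate_def j_def)
    next
      case 2: False
      then show ?thesis using False by (simp add: int_iterate_def j_def)
    qed
    moreover have "(inv_into S f ^^ j) x \<in> S"
      using bij_betw_apply[OF bij_betw_inv_into[OF f]] by (induction j) (simp_all add: x)
    ultimately show ?thesis
      using False bij_betw_inv_into_right[OF f] by (simp add: int_iterate_def k)
  qed
  show ?case using Suc.IH step[of "int n + k"] by (simp add: algebra_simps)
qed simp

context additive_category
begin

lemma hom_group_simps [simp]:
  "carrier (hom_group C X Y) = Hom C X Y"
  "x \<otimes>\<^bsub>hom_group C X Y\<^esub> y = x \<boxplus> y"
  "\<one>\<^bsub>hom_group C X Y\<^esub> = Zer C X Y"
  by (simp_all add: hom_group_def)

lemma hom_group_group: "\<lbrakk>X \<in> Obj C; Y \<in> Obj C\<rbrakk> \<Longrightarrow> group (hom_group C X Y)"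
  using hom_comm_group comm_group.axioms(2) by blast

lemma group_hom_Cmp_left:
  assumes "X \<in> Obj C" "Y \<in> Obj C" "Z \<in> Obj C" "g \<in> Hom C Y Z"
  shows "group_hom (hom_group C X Y) (hom_group C X Z) (\<lambda>f. g \<bullet> f)"
  using assms hom_group_group Cmp_closed[OF assms(1-3) _ assms(4)] Cmp_distrib_right[OF assms(1-3)]
  by (auto simp: group_hom_def group_hom_axioms_def hom_def)

lemma group_hom_Cmp_right:
  assumes "X \<in> Obj C" "Y \<in> Obj C" "Z \<in> Obj C" "f \<in> Hom C X Y"
  shows "group_hom (hom_group C Y Z) (hom_group C X Z) (\<lambda>g. g \<bullet> f)"
  using assms hom_group_group Cmp_closed[OF assms(1-4)] Cmp_distrib_left[OF assms(1-3)]
  by (auto simp: group_hom_def group_hom_axioms_def hom_def)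

end

context triangulated_category
begin

lemma Shift_funpow_closed: "X \<in> Obj C \<Longrightarrow> (Shift C ^^ i) X \<in> Obj C"
  by (induction i) (auto intro: bij_betw_apply[OF Shift_bij])

lemma shift_pow_closed: "X \<in> Obj C \<Longrightarrow> shift_pow C k X \<in> Obj C"
  unfolding shift_pow_def by (rule int_iterate_closed[OF Shift_bij])

lemma shift_pow_add: "X \<in> Obj C \<Longrightarrow> (Shift C ^^ i) (shift_pow C k X) = shift_pow C (int i + k) X"
  unfolding shift_pow_def by (rule int_iterate_add[OF Shift_bij])

lemma group_hom_ShiftA_funpow:
  assumes "X \<in> Obj C" "Y \<in> Obj C"
  shows "group_hom (hom_group C X Y) (hom_group C ((Shift C ^^ i) X) ((Shift C ^^ i) Y))
    (ShiftA C ^^ i)"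
proof -
  have "ShiftA C ^^ i \<in> hom (hom_group C X Y) (hom_group C ((Shift C ^^ i) X) ((Shift C ^^ i) Y))"
  proof (induction i)
    case (Suc i)
    have "ShiftA C \<in> hom (hom_group C ((Shift C ^^ i) X) ((Shift C ^^ i) Y))
      (hom_group C ((Shift C ^^ Suc i) X) ((Shift C ^^ Suc i) Y))"
      using bij_betw_apply[OF ShiftA_bij] ShiftA_Pls[of "(Shift C ^^ i) X" "(Shift C ^^ i) Y"]
      by (simp add: hom_def Shift_funpow_closed assms)
    from hom_compose[OF Suc.IH this] show ?case by (simp add: comp_def)
  qed (simp add: hom_def)
  then show ?thesis
    using assms hom_group_group Shift_funpow_closed by (simp add: group_hom_def group_hom_axioms_def)
qed

lemma ShiftA_funpow_closed:
  "\<lbrakk>X \<in> Obj C; Y \<in> Obj C; f \<in> Hom C X Y\<rbrakk> \<Longrightarrow>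
    (ShiftA C ^^ i) f \<in> Hom C ((Shift C ^^ i) X) ((Shift C ^^ i) Y)"
  using group_hom.hom_closed[OF group_hom_ShiftA_funpow] by simp

lemma ShiftA_funpow_Cmp:
  assumes "X \<in> Obj C" "Y \<in> Obj C" "Z \<in> Obj C" "f \<in> Hom C X Y" "g \<in> Hom C Y Z"
  shows "(ShiftA C ^^ i) (g \<bullet> f) = (ShiftA C ^^ i) g \<bullet> (ShiftA C ^^ i) f"
proof (induction i)
  case (Suc i)
  then show ?case
    using ShiftA_Cmp[OF Shift_funpow_closed[of _ i] Shift_funpow_closed[of _ i]
        Shift_funpow_closed[of _ i] ShiftA_funpow_closed[of X Y f i] ShiftA_funpow_closed[of Y Z g i]]
      assms by simp
qed simp

lemma hom_deg_simps [simp]: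
  "carrier (hom_deg C X Y n) = Hom C X (shift_pow C n Y)"
  "\<one>\<^bsub>hom_deg C X Y n\<^esub> = Zer C X (shift_pow C n Y)"
  by (simp_all add: hom_deg_def)

lemma hom_deg_comm_group: "\<lbrakk>X \<in> Obj C; Y \<in> Obj C\<rbrakk> \<Longrightarrow> comm_group (hom_deg C X Y n)"
  unfolding hom_deg_def using hom_comm_group shift_pow_closed by blast

lemma hom_deg_group: "\<lbrakk>X \<in> Obj C; Y \<in> Obj C\<rbrakk> \<Longrightarrow> group (hom_deg C X Y n)"
  using hom_deg_comm_group comm_group.axioms(2) by blast

lemma deg_prod_int: "deg_prod C (int i) g f = (ShiftA C ^^ i) g \<bullet> f"
  by (simp add: deg_prod_def shift_arr_pow_def)

lemma ShiftA_funpow_shift_pow_closed: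
  assumes "Y \<in> Obj C" "Z \<in> Obj C" "g \<in> Hom C Y (shift_pow C k Z)"
  shows "(ShiftA C ^^ i) g \<in> Hom C (shift_pow C (int i) Y) (shift_pow C (int i + k) Z)"
  using ShiftA_funpow_closed[OF assms(1) shift_pow_closed[OF assms(2)] assms(3), of i] assms
  by (simp add: shift_pow_add) (simp add: shift_pow_def)

text \<open>Only \<open>\<Sigma>\<^sup>i\<close> with \<open>i \<ge> 0\<close> is ever applied to a morphism, so \<open>\<Sigma>\<^sup>i\<close> on morphisms is an iterate of
  \<open>ShiftA\<close>; the degree \<open>k\<close> of the left factor is arbitrary.\<close>

lemma group_hom_deg_prod_left:
  assumes "X \<in> Obj C" "Y \<in> Obj C" "Z \<in> Obj C" "g \<in> Hom C Y (shift_pow C k Z)"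
  shows "group_hom (hom_deg C X Y (int i)) (hom_deg C X Z (int i + k)) (deg_prod C (int i) g)"
  unfolding deg_prod_int hom_deg_def
  using assms ShiftA_funpow_shift_pow_closed[OF assms(2-4)] shift_pow_closed
  by (intro group_hom_Cmp_left) auto

lemma deg_prod_closed:
  assumes "X \<in> Obj C" "Y \<in> Obj C" "Z \<in> Obj C" "g \<in> Hom C Y (shift_pow C k Z)"
    and "f \<in> Hom C X (shift_pow C (int i) Y)"
  shows "deg_prod C (int i) g f \<in> Hom C X (shift_pow C (int i + k) Z)"
  using group_hom.hom_closed[OF group_hom_deg_prod_left[OF assms(1-4)]] assms(5) by simp

lemma deg_prod_Zer:
  assumes "X \<in> Obj C" "Y \<in> Obj C" "Z \<in> Obj C" "f \<in> Hom C X (shift_pow C (int i) Y)"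
  shows "deg_prod C (int i) (Zer C Y (shift_pow C k Z)) f = Zer C X (shift_pow C (int i + k) Z)"
proof -
  have "(ShiftA C ^^ i) (Zer C Y (shift_pow C k Z)) =
      Zer C (shift_pow C (int i) Y) (shift_pow C (int i + k) Z)"
    using group_hom.hom_one[OF group_hom_ShiftA_funpow[OF assms(2) shift_pow_closed[OF assms(3)]],
          of i k]
      assms by (simp add: shift_pow_add) (simp add: shift_pow_def)
  then show ?thesis
    using group_hom.hom_one[OF group_hom_Cmp_right[OF assms(1) shift_pow_closed[OF assms(2)]
          shift_pow_closed[OF assms(3)] assms(4), of "int i + k"]]
    by (simp add: deg_prod_int)
qed

lemma deg_prod_assoc:
  assumes "X \<in> Obj C" "Y \<in> Obj C" "Z \<in> Obj C" "W \<in> Obj C"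
    and h: "h \<in> Hom C Z (shift_pow C k W)" and g: "g \<in> Hom C Y (shift_pow C (int j) Z)"
    and f: "f \<in> Hom C X (shift_pow C (int i) Y)"
  shows "deg_prod C (int (i + j)) h (deg_prod C (int i) g f) =
    deg_prod C (int i) (deg_prod C (int j) h g) f"
proof -
  have g': "(ShiftA C ^^ i) g \<in> Hom C (shift_pow C (int i) Y) (shift_pow C (int i + int j) Z)"
    using ShiftA_funpow_shift_pow_closed[OF assms(2,3) g] .
  have hj: "(ShiftA C ^^ j) h \<in> Hom C (shift_pow C (int j) Z) (shift_pow C (int j + k) W)"
    using ShiftA_funpow_shift_pow_closed[OF assms(3,4) h] .
  have h': "(ShiftA C ^^ (i + j)) h \<in>
      Hom C (shift_pow C (int i + int j) Z) (shift_pow C (int i + int j + k) W)"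
    using ShiftA_funpow_shift_pow_closed[OF assms(3,4) h, of "i + j"] by simp
  have "(ShiftA C ^^ i) (deg_prod C (int j) h g) = (ShiftA C ^^ (i + j)) h \<bullet> (ShiftA C ^^ i) g"
    using ShiftA_funpow_Cmp[OF assms(2) shift_pow_closed[OF assms(3)]
        shift_pow_closed[OF assms(4)] g hj, of i]
    by (simp add: deg_prod_int funpow_add)
  moreover have "((ShiftA C ^^ (i + j)) h \<bullet> (ShiftA C ^^ i) g) \<bullet> f =
      (ShiftA C ^^ (i + j)) h \<bullet> ((ShiftA C ^^ i) g \<bullet> f)"
    by (rule Cmp_assoc[OF _ _ _ _ f g' h']) (simp_all add: assms shift_pow_closed)
  ultimately show ?thesis by (simp add: deg_prod_int del: of_nat_add)
qed

end


section \<open>Subgroups of direct sums\<close>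

lemma (in comm_group) finprod_in_subgroup:
  assumes N: "subgroup N G" and f: "\<And>i. i \<in> I \<Longrightarrow> f i \<in> N"
  shows "finprod G f I \<in> N"
  using f
proof (induction I rule: infinite_finite_induct)
  case (insert i I)
  then have "f \<in> I \<rightarrow> carrier G" "f i \<in> carrier G"
    using subgroup.mem_carrier[OF N] by auto
  then show ?case
    using insert subgroup.m_closed[OF N] by simp
qed (simp_all add: subgroup.one_closed[OF N])

lemma subgroup_sum_group_components:
  assumes G: "\<And>k. group (G k)" and P: "\<And>k. subgroup (P k) (G k)"
  shows "subgroup {x \<in> carrier (sum_group UNIV G). \<forall>k. x k \<in> P k} (sum_group UNIV G)"
proof (rule group.subgroupI)
  show "group (sum_group UNIV G)" using G by simp
  then have "\<one>\<^bsub>sum_group UNIV G\<^esub> \<in> {x \<in> carrier (sum_group UNIV G). \<forall>k. x k \<in> P k}"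
    using monoid.one_closed[OF group.is_monoid] subgroup.one_closed[OF P] by fastforce
  then show "{x \<in> carrier (sum_group UNIV G). \<forall>k. x k \<in> P k} \<noteq> {}" by blast
  show "inv\<^bsub>sum_group UNIV G\<^esub> x \<in> {x \<in> carrier (sum_group UNIV G). \<forall>k. x k \<in> P k}"
    if "x \<in> {x \<in> carrier (sum_group UNIV G). \<forall>k. x k \<in> P k}" for x
    using that group.inv_closed[OF \<open>group (sum_group UNIV G)\<close>, of x]
      inv_sum_group[of UNIV G x] G subgroup.m_inv_closed[OF P] by simp
  show "x \<otimes>\<^bsub>sum_group UNIV G\<^esub> y \<in> {x \<in> carrier (sum_group UNIV G). \<forall>k. x k \<in> P k}"
    if "x \<in> {x \<in> carrier (sum_group UNIV G). \<forall>k. x k \<in> P k}"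
      "y \<in> {x \<in> carrier (sum_group UNIV G). \<forall>k. x k \<in> P k}" for x y
    using that monoid.m_closed[OF group.is_monoid[OF \<open>group (sum_group UNIV G)\<close>], of x y]
      subgroup.m_closed[OF P] by simp
qed auto


section \<open>The graded module of morphisms\<close>

context central_ring_action
begin

lemma carrier_gr_hom:
  assumes "X \<in> Obj C" "Y \<in> Obj C"
  shows "carrier (gr_hom C X Y) =
    {x. (\<forall>k. x k \<in> Hom C X (shift_pow C k Y)) \<and> finite {k. x k \<noteq> Zer C X (shift_pow C k Y)}}"
  using carrier_sum_group[of UNIV "hom_deg C X Y"] hom_deg_group[OF assms]
  by (auto simp: gr_hom_def PiE_def Pi_def)

lemma gr_hom_group: "\<lbrakk>X \<in> Obj C; Y \<in> Obj C\<rbrakk> \<Longrightarrow> group (gr_hom C X Y)"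
  unfolding gr_hom_def by (rule sum_group) (rule hom_deg_group)

lemma \<phi>_closed:
  assumes "X \<in> Obj C" "h \<in> carrier H"
  shows "\<phi> X h \<in> carrier (gr_hom C X X)"
  using ring_hom_closed[OF \<phi>_hom[OF assms(1)] assms(2)] by (simp add: gr_end_def)

lemma gr_in_carrier: "x \<in> gr n \<Longrightarrow> x \<in> carrier H"
  using subgroup.mem_carrier[OF gr_subgroup] by fastforce

lemma zero_in_gr: "\<zero>\<^bsub>H\<^esub> \<in> gr n"
  using subgroup.one_closed[OF gr_subgroup[of n]] by simp

text \<open>Although \<open>h\<close> need not be homogeneous, in degree \<open>m\<close> only its component in \<open>H\<^sup>m\<close> contributes,
  because \<open>\<phi> X\<close> is additive and respects degrees. So \<open>H\<close> acts through its homogeneous elements.\<close>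

lemma \<phi>_homogeneous_component:
  assumes X: "X \<in> Obj C" and h: "h \<in> carrier H"
  shows "\<phi> X h k = Zer C X (shift_pow C k X) \<or> (\<exists>m. k = int m \<and> \<phi> X h k \<in> (\<lambda>g. \<phi> X g k) ` gr m)"
proof -
  have G: "group (hom_deg C X X k)" by (rule hom_deg_group[OF X X])
  obtain c where c: "\<And>n. c n \<in> gr n" "finite {n. c n \<noteq> \<zero>\<^bsub>H\<^esub>}"
    and h_eq: "h = finsum H c {n. c n \<noteq> \<zero>\<^bsub>H\<^esub>}"
    using gr_direct_sum[OF h] by blast
  have "\<phi> X (finsum H c F) k = Zer C X (shift_pow C k X) \<or>
      (\<exists>m\<in>F. k = int m \<and> \<phi> X (finsum H c F) k = \<phi> X (c m) k)" if "finite F" for F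
    using that
  proof (induction F rule: finite_induct)
    case empty
    \<comment> \<open>Zero lies in every \<open>H\<^sup>m\<close>, so its image vanishes in all degrees but \<open>m\<close>, whatever \<open>m\<close> is.\<close>
    obtain m where "k \<noteq> int m" by (metis nat_int n_not_Suc_n)
    then show ?case using \<phi>_graded[OF X zero_in_gr] by simp
  next
    case (insert n F)
    have c_car: "c \<in> F \<rightarrow> carrier H" "c n \<in> carrier H" using c(1) gr_in_carrier by auto
    have fin: "finsum H c F \<in> carrier H" by (rule finsum_closed[OF c_car(1)])
    have comp: "\<phi> X a k \<in> Hom C X (shift_pow C k X)" if "a \<in> carrier H" for a
      using \<phi>_closed[OF X that] by (simp add: carrier_gr_hom X)
    have "\<phi> X (finsum H c (insert n F)) k =
        \<phi> X (c n) k \<otimes>\<^bsub>hom_deg C X X k\<^esub> \<phi> X (finsum H c F) k"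
      using insert.hyps c_car ring_hom_add[OF \<phi>_hom[OF X] c_car(2) fin]
      by (simp add: gr_end_def gr_hom_def)
    moreover have "\<phi> X (c n) k = Zer C X (shift_pow C k X)" if "k \<noteq> int n"
      using \<phi>_graded[OF X c(1) that] by simp
    moreover have "\<phi> X (finsum H c F) k = Zer C X (shift_pow C k X)" if "k = int n"
      using insert.IH insert.hyps(2) that by auto
    ultimately show ?case
      using insert.IH comp[OF c_car(2)] comp[OF fin]
        monoid.l_one[OF group.is_monoid[OF G]] monoid.r_one[OF group.is_monoid[OF G]]
      by (cases "k = int n") auto
  qed
  from this[OF c(2)] show ?thesis using c(1) unfolding h_eq by auto
qed

end

locale hom_action = central_ring_action C H gr \<phi>
  for C :: "('o, 'm, 'z) tri_cat_scheme" and H :: "('h, 'y) ring_scheme" and gr and \<phi> +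
  fixes A B :: 'o
  assumes A: "A \<in> Obj C" and B: "B \<in> Obj C"
begin

definition scalars :: "nat \<Rightarrow> 'm set" where
  "scalars m = (\<lambda>h. \<phi> B h (int m)) ` gr m"

lemma scalars_closed: "u \<in> scalars m \<Longrightarrow> u \<in> Hom C B (shift_pow C (int m) B)"
  using \<phi>_closed[OF B gr_in_carrier] by (auto simp: scalars_def carrier_gr_hom B)

text \<open>Centrality turns the left action of \<open>u = \<phi> B x\<close> into the right action of \<open>y = \<phi> A x\<close> up to sign, and
  the right action commutes with the left action of \<open>v\<close> by associativity of composition products:
  \<open>u (v f) = \<plusminus> (v f) y = \<plusminus> v (f y) = \<plusminus> v (u f)\<close>.\<close>

lemma scalars_commute:
  assumes u: "u \<in> scalars m" and v: "v \<in> scalars l" and f: "f \<in> Hom C A (shift_pow C (int i) B)"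
  shows "deg_prod C (int (i + l)) u (deg_prod C (int i) v f) =
      deg_prod C (int (i + m)) v (deg_prod C (int i) u f) \<or>
    deg_prod C (int (i + l)) u (deg_prod C (int i) v f) =
      inv\<^bsub>hom_deg C A B (int (i + m + l))\<^esub> (deg_prod C (int (i + m)) v (deg_prod C (int i) u f))"
proof -
  obtain x where x: "x \<in> gr m" "u = \<phi> B x (int m)" using u by (auto simp: scalars_def)
  define y where "y = \<phi> A x (int m)"
  have y: "y \<in> Hom C A (shift_pow C (int m) A)"
    using \<phi>_closed[OF A gr_in_carrier[OF x(1)]] by (simp add: carrier_gr_hom A y_def)
  have vB: "v \<in> Hom C B (shift_pow C (int l) B)" by (rule scalars_closed[OF v])
  have uB: "u \<in> Hom C B (shift_pow C (int m) B)" by (rule scalars_closed[OF u])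
  have vf: "deg_prod C (int i) v f \<in> Hom C A (shift_pow C (int (i + l)) B)"
    using deg_prod_closed[OF A B B vB f] by simp
  have fy: "deg_prod C (int m) f y \<in> Hom C A (shift_pow C (int (i + m)) B)"
    using deg_prod_closed[OF A A B f y] by (simp add: add.commute)
  interpret v: group_hom "hom_deg C A B (int (i + m))" "hom_deg C A B (int (i + m + l))"
    "deg_prod C (int (i + m)) v"
    using group_hom_deg_prod_left[OF A B B vB, of "i + m"] by simp
  have flip: "deg_prod C (int n) u g = deg_prod C (int m) g y \<or>
      deg_prod C (int n) u g = inv\<^bsub>hom_deg C A B (int (n + m))\<^esub> (deg_prod C (int m) g y)"
    if "g \<in> Hom C A (shift_pow C (int n) B)" for n g
    using \<phi>_central[OF A B x(1) that] by (auto simp: x(2) y_def add.commute split: if_splits)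
  have assoc: "deg_prod C (int (i + m)) v (deg_prod C (int m) f y) =
      deg_prod C (int m) (deg_prod C (int i) v f) y"
    using deg_prod_assoc[OF A A B B vB f y] by (simp add: add.commute)
  have inv: "deg_prod C (int (i + m)) v (inv\<^bsub>hom_deg C A B (int (i + m))\<^esub> (deg_prod C (int m) f y)) =
     inv\<^bsub>hom_deg C A B (int (i + m + l))\<^esub> (deg_prod C (int (i + m)) v (deg_prod C (int m) f y))"
    using fy by (intro v.hom_inv) simp
  have car: "deg_prod C (int (i + m)) v (deg_prod C (int m) f y) \<in>
      carrier (hom_deg C A B (int (i + m + l)))"
    using fy by (intro v.hom_closed) simp
  have deg: "int (i + l + m) = int (i + m + l)" by simp
  show ?thesis
    using flip[OF f] flip[OF vf, unfolded deg] assoc inv v.H.inv_inv[OF car] by metis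
qed

abbreviation G :: "nat \<Rightarrow> 'm monoid" where
  "G i \<equiv> hom_deg C A B (int i)"

sublocale graded_operators G scalars "\<lambda>i. deg_prod C (int i)"
proof (rule graded_operators.intro)
  show "comm_group (G i)" for i by (rule hom_deg_comm_group[OF A B])
  show "deg_prod C (int i) u \<in> hom (G i) (G (i + m))" if "u \<in> scalars m" for u m i
    using group_hom.homh[OF group_hom_deg_prod_left[OF A B B scalars_closed[OF that], of i]] by simp
qed (use scalars_commute in auto)

definition family_at :: "(nat \<Rightarrow> 'm set) \<Rightarrow> int \<Rightarrow> 'm set" where
  "family_at N k = (if 0 \<le> k then N (nat k) else {Zer C A (shift_pow C k B)})"

definition direct_sum_of :: "(nat \<Rightarrow> 'm set) \<Rightarrow> (int \<Rightarrow> 'm) set" where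
  "direct_sum_of N = {x \<in> carrier (gr_hom C A B). \<forall>k. x k \<in> family_at N k}"

lemma subgroup_family_at:
  assumes "graded_submodule N"
  shows "subgroup (family_at N k) (hom_deg C A B k)"
  using graded_submoduleD(1)[OF assms, of "nat k"] group.triv_subgroup[OF hom_deg_group[OF A B, of k]]
  by (cases "0 \<le> k") (auto simp: family_at_def)

text \<open>Each component of \<open>h x\<close> is a finite sum of products of a homogeneous component of \<open>h\<close> with a
  component of \<open>x\<close>, so it remains in \<open>N\<close>. The support of \<open>h x\<close> is contained in the sum of the
  supports of \<open>\<phi> B h\<close> and \<open>x\<close>.\<close>

lemma gr_prod_in_direct_sum:
  assumes N: "graded_submodule N" and h: "h \<in> carrier H" and x: "x \<in> direct_sum_of N"
  shows "gr_prod C A B B (\<phi> B h) x \<in> direct_sum_of N"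
proof -
  define S where "S = {n. x n \<noteq> Zer C A (shift_pow C n B)}"
  define Y where "Y = {n. \<phi> B h n \<noteq> Zer C B (shift_pow C n B)}"
  define t where "t = (\<lambda>k n. deg_prod C n (\<phi> B h (k - n)) (x n))"
  have prod: "gr_prod C A B B (\<phi> B h) x k = finprod (hom_deg C A B k) (t k) S" for k
    by (simp add: gr_prod_def t_def S_def)
  have xk: "x k \<in> family_at N k" "x k \<in> Hom C A (shift_pow C k B)" for k
    using x A B by (simp_all add: direct_sum_of_def carrier_gr_hom)
  have S_nonneg: "0 \<le> n" if "n \<in> S" for n
    using xk(1)[of n] that by (auto simp: S_def family_at_def split: if_splits)
  have zero: "t k n = Zer C A (shift_pow C k B)" if "n \<in> S" "k - n \<notin> Y" for k n
  proof -
    obtain i where i: "n = int i" using S_nonneg[OF \<open>n \<in> S\<close>] nonneg_int_cases by blast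
    show ?thesis
      using deg_prod_Zer[OF A B B xk(2)[of "int i"], of "k - n"] that(2) by (simp add: Y_def t_def i)
  qed
  have term_in: "t k n \<in> family_at N k" if n: "n \<in> S" for k n
  proof (cases "k - n \<in> Y")
    case False
    then show ?thesis
      using zero[OF n] subgroup.one_closed[OF subgroup_family_at[OF N, of k]] by simp
  next
    case True
    obtain i where i: "n = int i" using S_nonneg[OF n] nonneg_int_cases by blast
    obtain m where m: "k - n = int m" "\<phi> B h (k - n) \<in> scalars m"
      using \<phi>_homogeneous_component[OF B h, of "k - n"] True by (auto simp: Y_def scalars_def)
    have k: "k = int (i + m)" using m(1) i by simp
    have "x (int i) \<in> N i" using xk(1)[of "int i"] by (simp add: family_at_def)
    from graded_submoduleD(2)[OF N m(2) this] show ?thesis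
      by (simp add: t_def i family_at_def k del: of_nat_add)
  qed
  have in_family: "gr_prod C A B B (\<phi> B h) x k \<in> family_at N k" for k
    unfolding prod
    by (rule comm_group.finprod_in_subgroup[OF hom_deg_comm_group[OF A B] subgroup_family_at[OF N]
        term_in])
  have "{k. gr_prod C A B B (\<phi> B h) x k \<noteq> Zer C A (shift_pow C k B)} \<subseteq> (\<lambda>(a, b). a + b) ` (Y \<times> S)"
  proof
    fix k assume "k \<in> {k. gr_prod C A B B (\<phi> B h) x k \<noteq> Zer C A (shift_pow C k B)}"
    then obtain n where "n \<in> S" "t k n \<noteq> Zer C A (shift_pow C k B)"
      using comm_monoid.finprod_one_eqI[OF comm_group.axioms(1)[OF hom_deg_comm_group[OF A B]], of S "t k" k]
      by (auto simp: prod)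
    then have "(k - n, n) \<in> Y \<times> S" using zero by blast
    then show "k \<in> (\<lambda>(a, b). a + b) ` (Y \<times> S)" by force
  qed
  moreover have "finite Y" "finite S"
    using \<phi>_closed[OF B h] x A B by (simp_all add: Y_def S_def direct_sum_of_def carrier_gr_hom)
  ultimately have "finite {k. gr_prod C A B B (\<phi> B h) x k \<noteq> Zer C A (shift_pow C k B)}"
    using finite_subset by blast
  then show ?thesis
    using in_family subgroup.mem_carrier[OF subgroup_family_at[OF N] in_family]
    by (simp add: direct_sum_of_def carrier_gr_hom A B)
qed

definition above :: "nat \<Rightarrow> nat \<Rightarrow> 'm set" where
  "above p i = (if p \<le> i then carrier (G i) else {\<one>\<^bsub>G i\<^esub>})"

lemma graded_submodule_above: "graded_submodule (above p)"
  unfolding graded_submodule_def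
proof (intro conjI allI ballI)
  show "subgroup (above p i) (G i)" for i
    using group.subgroup_self[OF group_G] group.triv_subgroup[OF group_G]
    by (simp add: above_def del: hom_deg_simps)
  fix m u i f assume u: "u \<in> scalars m" and f: "f \<in> above p i"
  show "deg_prod C (int i) u f \<in> above p (i + m)"
    using f group_hom.hom_closed[OF group_hom_act[OF u], of f i]
      group_hom.hom_one[OF group_hom_act[OF u], of i]
      monoid.one_closed[OF group.is_monoid[OF group_G], of "i + m"]
    by (auto simp: above_def simp del: hom_deg_simps split: if_splits)
qed

lemma submodule_direct_sum:
  assumes N: "graded_submodule N" and N_above: "\<And>i. N i \<subseteq> above p i" and p: "n\<^sub>0 \<le> int p"
  shows "submodule (direct_sum_of N) H (gr_hom_ge_module C \<phi> A B n\<^sub>0)"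
proof -
  let ?M = "gr_hom_ge_module C \<phi> A B n\<^sub>0"
  let ?P = "\<lambda>k. if k < n\<^sub>0 then {\<one>\<^bsub>hom_deg C A B k\<^esub>} else carrier (hom_deg C A B k)"
  have G: "group (hom_deg C A B k)" for k by (rule hom_deg_group[OF A B])
  have "carrier ?M = {x \<in> carrier (gr_hom C A B). \<forall>k. x k \<in> ?P k}"
    by (auto simp: gr_hom_ge_module_def carrier_gr_hom A B)
  moreover have "subgroup {x \<in> carrier (gr_hom C A B). \<forall>k. x k \<in> ?P k} (gr_hom C A B)"
    unfolding gr_hom_def
    by (rule subgroup_sum_group_components[OF G])
      (simp add: group.subgroup_self[OF G] group.triv_subgroup[OF G] del: hom_deg_simps)
  ultimately have M: "subgroup (carrier ?M) (gr_hom C A B)" by simp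
  have tot: "subgroup (direct_sum_of N) (gr_hom C A B)"
    unfolding direct_sum_of_def gr_hom_def
    by (rule subgroup_sum_group_components[OF G subgroup_family_at[OF N]])
  have "x k = Zer C A (shift_pow C k B)" if x: "x \<in> direct_sum_of N" and k: "k < n\<^sub>0" for x k
  proof (cases "k < 0")
    case True
    then show ?thesis using x by (auto simp: direct_sum_of_def family_at_def dest: spec[of _ k])
  next
    case False
    then have "x k \<in> N (nat k)" using x by (auto simp: direct_sum_of_def family_at_def dest: spec[of _ k])
    then have "x k \<in> above p (nat k)" using N_above by blast
    moreover have "\<not> p \<le> nat k" using False k p by linarith
    ultimately show ?thesis using False by (simp add: above_def)
  qed
  then have incl: "direct_sum_of N \<subseteq> carrier ?M"
    by (auto simp: gr_hom_ge_module_def) (simp add: direct_sum_of_def)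
  have "subgroup (direct_sum_of N) ((gr_hom C A B)\<lparr>carrier := carrier ?M\<rparr>)"
    by (rule group.subgroup_incl[OF gr_hom_group[OF A B] tot M incl])
  then have "subgroup (direct_sum_of N) (add_monoid ?M)"
    by (simp add: subgroup_def m_inv_def gr_hom_ge_module_def)
  moreover have "h \<odot>\<^bsub>?M\<^esub> x \<in> direct_sum_of N" if "h \<in> carrier H" "x \<in> direct_sum_of N" for h x
    using gr_prod_in_direct_sum[OF N that] by (simp add: gr_hom_ge_module_def)
  ultimately show ?thesis
    by (simp add: submodule_def submodule_axioms_def)
qed

text \<open>Tested on elements concentrated in one degree. Hence \<open>direct_sum_of\<close> is injective on graded
  submodules, and a maximal \<open>direct_sum_of N\<close> comes from a maximal \<open>N\<close>.\<close>

lemma direct_sum_le_cancel: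
  assumes N: "graded_submodule N" and K: "graded_submodule K" and sub: "direct_sum_of N \<subseteq> direct_sum_of K"
  shows "N i \<subseteq> K i"
proof
  fix f assume f: "f \<in> N i"
  define x where "x = (\<lambda>k. if k = int i then f else Zer C A (shift_pow C k B))"
  have one: "Zer C A (shift_pow C k B) \<in> family_at N k" for k
    using subgroup.one_closed[OF subgroup_family_at[OF N, of k]] by simp
  have mem: "x k \<in> family_at N k" for k
    using f one[of k] by (auto simp: x_def) (simp add: family_at_def)
  have "{k. x k \<noteq> Zer C A (shift_pow C k B)} \<subseteq> {int i}" by (auto simp: x_def)
  then have "finite {k. x k \<noteq> Zer C A (shift_pow C k B)}" using finite_subset by blast
  then have "x \<in> direct_sum_of N"
    using mem subgroup.mem_carrier[OF subgroup_family_at[OF N] mem]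
    by (simp add: direct_sum_of_def carrier_gr_hom A B)
  then have "x (int i) \<in> family_at K (int i)" using sub by (auto simp: direct_sum_of_def)
  then show "f \<in> K i" by (simp add: x_def family_at_def)
qed

text \<open>The abstract argument is applied to \<open>T = above p\<close>, where \<open>p\<close> is at least both \<open>0\<close> and \<open>n\<^sub>0\<close>:
  graded submodules of it are submodules of the Noetherian module, and no negative shift acts on
  morphisms.\<close>

theorem nonzero_residue_class_hom:
  assumes noeth: "noetherian_module H (gr_hom_ge_module C \<phi> A B n\<^sub>0)"
    and unbounded: "\<And>b::int. \<exists>n\<ge>b. Hom C A (shift_pow C n B) \<noteq> {Zer C A (shift_pow C n B)}"
  shows "\<exists>d>0. \<exists>b r. \<forall>n\<ge>b. n mod d = r mod d \<longrightarrow>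
    Hom C A (shift_pow C (int n) B) \<noteq> {Zer C A (shift_pow C (int n) B)}"
proof -
  define p where "p = nat n\<^sub>0"
  have p: "n\<^sub>0 \<le> int p" by (simp add: p_def)
  have "\<exists>d>0. \<exists>b r. \<forall>n\<ge>b. n mod d = r mod d \<longrightarrow> above p n \<noteq> {\<one>\<^bsub>G n\<^esub>}"
  proof (rule nonzero_residue_class[OF graded_submodule_above])
    fix F assume ne: "F \<noteq> {}"
      and F: "\<And>N. N \<in> F \<Longrightarrow> graded_submodule N \<and> (\<forall>i. N i \<subseteq> above p i)"
    have "\<exists>X\<in>direct_sum_of ` F. \<forall>Y\<in>direct_sum_of ` F. X \<subseteq> Y \<longrightarrow> Y = X"
      using ne F submodule_direct_sum[OF _ _ p] by (intro noetherian_module_maximal[OF noeth]) blast+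
    then obtain N where N: "N \<in> F" "\<And>N'. N' \<in> F \<Longrightarrow> direct_sum_of N \<subseteq> direct_sum_of N' \<Longrightarrow>
        direct_sum_of N' = direct_sum_of N"
      by blast
    have "N' = N" if N': "N' \<in> F" "\<forall>i. N i \<subseteq> N' i" for N'
    proof -
      have "direct_sum_of N \<subseteq> direct_sum_of N'" using N'(2) by (auto simp: direct_sum_of_def family_at_def)
      then have "direct_sum_of N' = direct_sum_of N" using N(2) N'(1) by blast
      then have "N' i \<subseteq> N i" for i using direct_sum_le_cancel F N(1) N'(1) by blast
      then show ?thesis using N'(2) by blast
    qed
    then show "\<exists>N\<in>F. \<forall>N'\<in>F. (\<forall>i. N i \<subseteq> N' i) \<longrightarrow> N' = N" using N(1) by blast
  next
    fix b :: nat
    obtain n where n: "n \<ge> int (max b p)" "Hom C A (shift_pow C n B) \<noteq> {Zer C A (shift_pow C n B)}"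
      using unbounded by blast
    then have "nat n \<ge> b \<and> above p (nat n) \<noteq> {\<one>\<^bsub>G (nat n)\<^esub>}" by (auto simp: above_def)
    then show "\<exists>n\<ge>b. above p n \<noteq> {\<one>\<^bsub>G n\<^esub>}" by blast
  qed
  then obtain d b r where "d > 0"
    and db: "\<And>n. \<lbrakk>n \<ge> b; n mod d = r mod d\<rbrakk> \<Longrightarrow> above p n \<noteq> {\<one>\<^bsub>G n\<^esub>}"
    by blast
  have "Hom C A (shift_pow C (int n) B) \<noteq> {Zer C A (shift_pow C (int n) B)}"
    if "n \<ge> b" "n mod d = r mod d" for n
    using db[OF that] by (auto simp: above_def split: if_splits)
  then show ?thesis using \<open>d > 0\<close> by blast
qed

end

theorem theorem1:
  fixes C :: "('o, 'm) tri_cat" and H :: "'h ring" and gr :: "nat \<Rightarrow> 'h set"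
    and \<phi> :: "'o \<Rightarrow> 'h \<Rightarrow> int \<Rightarrow> 'm" and A B :: 'o
  assumes "central_ring_action C H gr \<phi>"
    and "A \<in> Obj C" and "B \<in> Obj C"
    and "\<exists>n\<^sub>0. noetherian_module H (gr_hom_ge_module C \<phi> A B n\<^sub>0)"
    and "(\<exists>N. \<forall>n\<ge>N. finite_length (degree_zero_ring H gr) (hom_module C \<phi> A B n)) \<or>
      (contains_infinite_field (degree_zero_ring H gr) \<or>
       local_with_infinite_residue_field (degree_zero_ring H gr))"
  shows "(\<exists>N::int. \<forall>n\<ge>N. Hom C A (shift_pow C n B) = {Zer C A (shift_pow C n B)}) \<or>
    (\<exists>d m\<^sub>0 :: int. d > 0 \<and>
      (\<exists>j. 0 \<le> j \<and> j < d \<and>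
        (\<forall>n\<ge>m\<^sub>0. n mod d = j mod d \<longrightarrow>
           Hom C A (shift_pow C n B) \<noteq> {Zer C A (shift_pow C n B)})))"
proof (rule disj_imp[THEN iffD2], rule impI)
  assume unb: "\<not> (\<exists>N::int. \<forall>n\<ge>N. Hom C A (shift_pow C n B) = {Zer C A (shift_pow C n B)})"
  interpret hom_action C H gr \<phi> A B
    using assms(1-3) by (simp add: hom_action_def hom_action_axioms_def)
  obtain n\<^sub>0 where "noetherian_module H (gr_hom_ge_module C \<phi> A B n\<^sub>0)" using assms(4) by blast
  from nonzero_residue_class_hom[OF this] obtain d b r where d: "d > 0"
    and nz: "\<And>n. \<lbrakk>n \<ge> b; n mod d = r mod d\<rbrakk> \<Longrightarrow>
      Hom C A (shift_pow C (int n) B) \<noteq> {Zer C A (shift_pow C (int n) B)}"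
    using unb by (smt (verit))
  have "Hom C A (shift_pow C n B) \<noteq> {Zer C A (shift_pow C n B)}"
    if n: "n \<ge> int b" "n mod int d = int (r mod d) mod int d" for n
  proof -
    obtain k where k: "n = int k" using n(1) by (metis nonneg_int_cases of_nat_0_le_iff order_trans)
    have "k mod d = r mod d" using n(2) unfolding k by (metis mod_mod_trivial of_nat_eq_iff of_nat_mod)
    then show ?thesis using nz[of k] n(1) by (simp add: k)
  qed
  moreover have "0 \<le> int (r mod d)" "int (r mod d) < int d" "0 < int d"
    using d by (auto intro: of_nat_0_le_iff)
  ultimately show "\<exists>d m\<^sub>0 :: int. d > 0 \<and>
      (\<exists>j. 0 \<le> j \<and> j < d \<and>
        (\<forall>n\<ge>m\<^sub>0. n mod d = j mod d \<longrightarrow>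
           Hom C A (shift_pow C n B) \<noteq> {Zer C A (shift_pow C n B)}))"
    by blast
qed

end
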